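(* Let $(V,E)$ be a finite simple undirected graph and let $\Delta$ be its set of triangles, each viewed as a set of three edges. The optimization problem $$\min \sum_{e\in E}\Big(\sum_{T\in\Delta,\ e\in T} x_{T,e}\Big)^2\quad\text{s.t.}\quad \sum_{e\in T}x_{T,e}=1\ \ \forall T\in\Delta,\qquad x_{T,e}\in\{0,1\}\ \ \forall T\in\Delta,\ e\in T$$ can be solved optimally in $O(|\Delta|^4)$ time. *)

theory Defs
  imports Complex_Main "HOL-Library.Landau_Symbols"
begin

section \<open>The optimization problem\<close>

definition simple_graph :: "'a set \<Rightarrow> 'a set set \<Rightarrow> bool" where
  "simple_graph V E \<longleftrightarrow> finite V \<and> (\<forall>e\<in>E. e \<subseteq> V \<and> card e = 2)"

text \<open>If all members of E have two elements, then membership of the three pairs in E forces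
  u, v, w to be distinct, so that a triangle is a set of exactly three edges.\<close>

definition triangles :: "'a set set \<Rightarrow> 'a set set set" where
  "triangles E = {{{u, v}, {v, w}, {u, w}} | u v w. {u, v} \<in> E \<and> {v, w} \<in> E \<and> {u, w} \<in> E}"

definition feasible :: "'a set set \<Rightarrow> ('a set set \<Rightarrow> 'a set \<Rightarrow> nat) \<Rightarrow> bool" where
  "feasible E x \<longleftrightarrow>
     (\<forall>T\<in>triangles E. (\<Sum>e\<in>T. x T e) = 1) \<and> (\<forall>T\<in>triangles E. \<forall>e\<in>T. x T e \<in> {0, 1})"

definition cost :: "'a set set \<Rightarrow> ('a set set \<Rightarrow> 'a set \<Rightarrow> nat) \<Rightarrow> nat" where
  "cost E x = (\<Sum>e\<in>E. (\<Sum>T\<in>{T \<in> triangles E. e \<in> T}. x T e)\<^sup>2)"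

definition optimal :: "'a set set \<Rightarrow> ('a set set \<Rightarrow> 'a set \<Rightarrow> nat) \<Rightarrow> bool" where
  "optimal E x \<longleftrightarrow> feasible E x \<and> (\<forall>y. feasible E y \<longrightarrow> cost E x \<le> cost E y)"


section \<open>The machine model\<close>

text \<open>Programs are while-programs over the natural numbers with random-access memory and unit
  cost. A program mentions finitely many names, each denoting an unbounded array of natural
  numbers (a scalar is cell 0 of its array). The only arithmetic is addition and truncated
  subtraction, as in the random-access machines of Cook and Reckhow; in particular there is no
  unit-cost multiplication. Running time is the number of operations executed: every constant,
  memory read, arithmetic operation, comparison, connective, assignment and branch counts one.\<close>

type_synonym vname = string
type_synonym state = "vname \<Rightarrow> nat \<Rightarrow> nat"

datatype aexp = N nat | Rd vname aexp | Plus aexp aexp | Minus aexp aexp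

datatype bexp = Less aexp aexp | Neg bexp | And bexp bexp

datatype com =
    SKIP
  | Assign vname aexp aexp
  | Seq com com
  | If bexp com com
  | While bexp com

fun aval :: "aexp \<Rightarrow> state \<Rightarrow> nat" where
  "aval (N n) s = n"
| "aval (Rd x a) s = s x (aval a s)"
| "aval (Plus a b) s = aval a s + aval b s"
| "aval (Minus a b) s = aval a s - aval b s"

fun atime :: "aexp \<Rightarrow> nat" where
  "atime (N n) = 1"
| "atime (Rd x a) = 1 + atime a"
| "atime (Plus a b) = 1 + atime a + atime b"
| "atime (Minus a b) = 1 + atime a + atime b"

fun bval :: "bexp \<Rightarrow> state \<Rightarrow> bool" where
  "bval (Less a b) s \<longleftrightarrow> aval a s < aval b s"
| "bval (Neg b) s \<longleftrightarrow> \<not> bval b s"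
| "bval (And b c) s \<longleftrightarrow> bval b s \<and> bval c s"

fun btime :: "bexp \<Rightarrow> nat" where
  "btime (Less a b) = 1 + atime a + atime b"
| "btime (Neg b) = 1 + btime b"
| "btime (And b c) = 1 + btime b + btime c"

text \<open>\<open>runs c s t s'\<close>: started in s, the program c halts in s' after exactly t time units.
  \<open>Assign x a b\<close> stores the value of b in cell a of the array x.\<close>

inductive runs :: "com \<Rightarrow> state \<Rightarrow> nat \<Rightarrow> state \<Rightarrow> bool" where
  Skip: "runs SKIP s 1 s"
| Assign: "runs (Assign x a b) s (1 + atime a + atime b) (s(x := (s x)(aval a s := aval b s)))"
| Seq: "runs c1 s t1 s' \<Longrightarrow> runs c2 s' t2 s'' \<Longrightarrow> runs (Seq c1 c2) s (t1 + t2) s''"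
| IfTrue: "bval b s \<Longrightarrow> runs c1 s t s' \<Longrightarrow> runs (If b c1 c2) s (1 + btime b + t) s'"
| IfFalse: "\<not> bval b s \<Longrightarrow> runs c2 s t s' \<Longrightarrow> runs (If b c1 c2) s (1 + btime b + t) s'"
| WhileFalse: "\<not> bval b s \<Longrightarrow> runs (While b c) s (1 + btime b) s"
| WhileTrue: "bval b s \<Longrightarrow> runs c s t1 s' \<Longrightarrow> runs (While b c) s' t2 s'' \<Longrightarrow>
    runs (While b c) s (1 + btime b + t1 + t2) s''"

inductive_cases SkipE: "runs SKIP s t s'"
inductive_cases AssignE: "runs (Assign x a b) s t s'"
inductive_cases SeqE: "runs (Seq c1 c2) s t s'"

lemma runs_deterministic: "runs c s t s' \<Longrightarrow> runs c s u r \<Longrightarrow> u = t \<and> r = s'"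
proof (induction arbitrary: u r rule: runs.induct)
  case (Skip s)
  then show ?case by (rule SkipE) simp
next
  case (Assign x a b s)
  then show ?case by (rule AssignE) simp
next
  case (Seq c1 s t1 s' c2 t2 s'')
  from Seq.prems obtain u1 u2 r' where "u = u1 + u2" "runs c1 s u1 r'" "runs c2 r' u2 r"
    by (rule SeqE)
  with Seq.IH show ?case by simp
next
  case (IfTrue b s c1 t s' c2)
  from IfTrue.prems IfTrue.hyps obtain u1 where "u = 1 + btime b + u1" "runs c1 s u1 r"
    by cases simp_all
  with IfTrue.IH show ?case by simp
next
  case (IfFalse b s c2 t s' c1)
  from IfFalse.prems IfFalse.hyps obtain u1 where "u = 1 + btime b + u1" "runs c2 s u1 r"
    by cases simp_all
  with IfFalse.IH show ?case by simp
next
  case (WhileFalse b s c)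
  from WhileFalse.prems WhileFalse.hyps show ?case
    by cases simp_all
next
  case (WhileTrue b s c t1 s' t2 s'')
  from WhileTrue.prems WhileTrue.hyps obtain u1 u2 r' where
    "u = 1 + btime b + u1 + u2" "runs c s u1 r'" "runs (While b c) r' u2 r"
    by cases simp_all
  with WhileTrue.IH show ?case by auto
qed


section \<open>Input and output\<close>

text \<open>The edges and the triangles are numbered, in any order, by the lists es and ts. The input
  consists of the number of triangles, the number of edges, and a table listing the numbers of the
  three edges of each triangle (in any order). Cells that do not belong to the input are left
  arbitrary.\<close>

definition encodes :: "'a set set \<Rightarrow> 'a set list \<Rightarrow> 'a set set list \<Rightarrow> state \<Rightarrow> bool" where
  "encodes E es ts s \<longleftrightarrow>
     distinct es \<and> set es = E \<and> distinct ts \<and> set ts = triangles E \<and>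
     s ''num_triangles'' 0 = length ts \<and>
     s ''num_edges'' 0 = length es \<and>
     (\<forall>i<length ts. \<forall>j<3. s ''table'' (3 * i + j) < length es) \<and>
     (\<forall>i<length ts. ts ! i = {es ! (s ''table'' (3 * i + j)) | j. j < 3})"

text \<open>The output lists the values of x in the positions of the input table. The table is read
  off the initial state s because a program may overwrite its input.\<close>

definition outputs ::
  "'a set list \<Rightarrow> 'a set set list \<Rightarrow> state \<Rightarrow> state \<Rightarrow> ('a set set \<Rightarrow> 'a set \<Rightarrow> nat) \<Rightarrow> bool" where
  "outputs es ts s s' x \<longleftrightarrow>
     (\<forall>i<length ts. \<forall>j<3. s' ''x'' (3 * i + j) = x (ts ! i) (es ! (s ''table'' (3 * i + j))))"

text \<open>\<open>T n\<close> bounds the running time on all graphs with n triangles, whatever their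
  numbers of vertices and edges. The program and the bound may not depend on the graph; for the
  type nat of vertices, every finite graph occurs up to isomorphism.\<close>

definition solves_in_time :: "'a itself \<Rightarrow> com \<Rightarrow> (nat \<Rightarrow> nat) \<Rightarrow> bool" where
  "solves_in_time _ c T \<longleftrightarrow>
     (\<forall>(V :: 'a set) E es ts s. simple_graph V E \<longrightarrow> encodes E es ts s \<longrightarrow>
        (\<exists>t s' x. runs c s t s' \<and> t \<le> T (card (triangles E)) \<and>
                  outputs es ts s s' x \<and> optimal E x))"

end

theory Submission
  imports Defs "HOL-Real_Asymp.Real_Asymp"
begin

text \<open>Call the number of triangles charged to an edge its load; we minimize the sum of the squared
  loads. A push-relabel method does this. Fix a number K larger than the number of relevant edges,
  give each edge a label \<open>q\<close>, and maintain that the label of the edge charged by a triangle exceeds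
  those of its other edges by at most 1, and that \<open>q e \<le> K * load e\<close>. An edge is overfull if
  \<open>q e + K < K * load e\<close>. If a triangle charged to an overfull edge has an edge with a smaller label,
  charge it there instead (push); if no triangle allows a push, increment the label of some
  overfull edge (relabel). Each relabeling lowers \<open>K * n - (\<Sum>e. q e)\<close> by one and raises the sum of
  the labels of the charged edges by at most n, and a push lowers that sum, so there are O(n^3)
  steps of O(n) operations each. When no edge is overfull, a pigeonhole argument on the
  labels yields, for each k, a set of edges that contains all triangles charged to it and separates the
  loads above k from those below k; these sets certify optimality.\<close>


section \<open>Optimality of load vectors\<close>

definition load :: "'i set \<Rightarrow> ('i \<Rightarrow> 'e) \<Rightarrow> 'e \<Rightarrow> nat" where
  "load I f e = card {i \<in> I. f i = e}"

lemma load_eq_sum: "finite I \<Longrightarrow> load I f e = (\<Sum>i\<in>I. of_bool (f i = e))"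
  by (simp add: load_def Int_def)

lemma sum_load:
  assumes "finite I" "finite S"
  shows "(\<Sum>e\<in>S. load I f e) = card {i \<in> I. f i \<in> S}"
proof -
  have "(\<Sum>e\<in>S. load I f e) = (\<Sum>i\<in>I. \<Sum>e\<in>S. of_bool (f i = e))"
    using assms by (simp add: load_eq_sum sum.swap[of _ I S] del: sum_of_bool_eq)
  also have "\<dots> = (\<Sum>i\<in>I. of_bool (f i \<in> S))"
    using assms(2) by (intro sum.cong refl) (simp add: of_bool_def)
  finally show ?thesis
    using assms(1) by (simp add: Int_def)
qed

lemma load_le: "finite I \<Longrightarrow> load I f e \<le> card I"
  unfolding load_def by (intro card_mono) auto

lemma load_eq_0: "e \<notin> f ` I \<Longrightarrow> load I f e = 0"
  by (auto simp: load_def card_eq_0_iff)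

lemma load_Suc: "load {..<Suc k} f e = load {..<k} f e + of_bool (f k = e)"
  by (simp add: load_eq_sum del: sum_of_bool_eq)

lemma load_cong: "(\<And>i. i \<in> I \<Longrightarrow> f i = g i) \<Longrightarrow> load I f e = load I g e"
  by (auto simp: load_def intro!: arg_cong[where f = card])

lemma load_upd:
  assumes "finite I" "i \<in> I" "y \<noteq> f i"
  shows "load I (f(i := y)) e =
    (if e = y then load I f e + 1 else if e = f i then load I f e - 1 else load I f e)"
proof -
  have "load I g e = of_bool (g i = e) + load (I - {i}) g e" for g
    using assms by (simp only: load_eq_sum sum.remove[of I i] finite_Diff)
  moreover have "load (I - {i}) (f(i := y)) e = load (I - {i}) f e"
    by (auto simp: load_def intro!: arg_cong[where f = card])
  ultimately show ?thesis using assms(3) by auto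
qed

text \<open>Truncated subtraction makes the sum a triangular number whatever the bound
  \<open>N\<close>. A square thus becomes a combination of the hinge functions \<open>L - k\<close>,
  through which majorization controls sums of squares.\<close>

lemma square_eq_sum_diff: "L \<le> N \<Longrightarrow> L\<^sup>2 + L = 2 * (\<Sum>k<N. L - k)" for L N :: nat
proof (induction L)
  case (Suc L)
  have "(\<Sum>k<N. Suc L - k) = (\<Sum>k<N. (L - k) + of_bool (k \<le> L))"
    by (intro sum.cong) auto
  also have "\<dots> = (\<Sum>k<N. L - k) + card {k \<in> {..<N}. k \<le> L}"
    by (simp add: sum.distrib Int_def)
  also have "{k \<in> {..<N}. k \<le> L} = {..L}"
    using Suc.prems by auto
  finally show ?case using Suc by (simp add: power2_eq_square)
qed simp

text \<open>The sets S certify that f balances the loads: whatever is assigned to S has all its options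
  in S, so no assignment puts less load on S, and S separates the loads above k from
  those below k. Hence the loads of f are majorized by those of g.\<close>

lemma closed_sets_imp_square_sum_le:
  assumes fin: "finite I" "finite X"
    and g: "\<And>i. i \<in> I \<Longrightarrow> g i \<in> opts i"
    and X: "\<And>i. i \<in> I \<Longrightarrow> f i \<in> X" "\<And>i. i \<in> I \<Longrightarrow> g i \<in> X"
    and closed: "\<And>k. \<exists>S. (\<forall>i\<in>I. f i \<in> S \<longrightarrow> opts i \<subseteq> S) \<and>
        (\<forall>e\<in>X. k < load I f e \<longrightarrow> e \<in> S) \<and> (\<forall>e\<in>X \<inter> S. k \<le> load I f e)"
  shows "(\<Sum>e\<in>X. (load I f e)\<^sup>2) \<le> (\<Sum>e\<in>X. (load I g e)\<^sup>2)"
proof -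
  have major: "(\<Sum>e\<in>X. load I f e - k) \<le> (\<Sum>e\<in>X. load I g e - k)" for k
  proof -
    obtain S where S: "\<forall>i\<in>I. f i \<in> S \<longrightarrow> opts i \<subseteq> S"
      "\<forall>e\<in>X. k < load I f e \<longrightarrow> e \<in> S" "\<forall>e\<in>X \<inter> S. k \<le> load I f e"
      using closed[of k] by (elim exE conjE)
    have finS: "finite (X \<inter> S)" using fin by simp
    have "(\<Sum>e\<in>X. load I f e - k) = (\<Sum>e\<in>X \<inter> S. load I f e - k)"
      using S(2) fin by (intro sum.mono_neutral_right) (auto simp: not_less)
    \<comment> \<open>On \<open>S\<close> the loads of \<open>f\<close> are at least
      \<open>k\<close>, so the truncated subtraction is exact; for \<open>g\<close> only an
      inequality remains below, and it points the right way.\<close>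
    moreover have "(\<Sum>e\<in>X \<inter> S. load I f e - k) + (\<Sum>e\<in>X \<inter> S. k) = (\<Sum>e\<in>X \<inter> S. load I f e)"
      using S(3) by (subst sum.distrib[symmetric], intro sum.cong) auto
    moreover have "(\<Sum>e\<in>X \<inter> S. load I f e) \<le> (\<Sum>e\<in>X \<inter> S. load I g e)"
      unfolding sum_load[OF fin(1) finS] using S(1) g X fin by (intro card_mono) auto
    moreover have "(\<Sum>e\<in>X \<inter> S. load I g e) \<le> (\<Sum>e\<in>X \<inter> S. load I g e - k) + (\<Sum>e\<in>X \<inter> S. k)"
      by (subst sum.distrib[symmetric], intro sum_mono) auto
    moreover have "(\<Sum>e\<in>X \<inter> S. load I g e - k) \<le> (\<Sum>e\<in>X. load I g e - k)"
      using fin by (intro sum_mono2) auto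
    ultimately show ?thesis by linarith
  qed
  \<comment> \<open>The linear terms add up to \<open>card I\<close> for every assignment into
    \<open>X\<close>, so they cancel when \<open>f\<close> and \<open>g\<close> are
    compared.\<close>
  have sq: "(\<Sum>e\<in>X. (load I h e)\<^sup>2) + card I = 2 * (\<Sum>k<card I. \<Sum>e\<in>X. load I h e - k)"
    if "\<And>i. i \<in> I \<Longrightarrow> h i \<in> X" for h
  proof -
    have "{i \<in> I. h i \<in> X} = I" using that by auto
    then have "(\<Sum>e\<in>X. (load I h e)\<^sup>2) + card I = (\<Sum>e\<in>X. (load I h e)\<^sup>2 + load I h e)"
      using sum_load[OF fin, of h] by (simp add: sum.distrib)
    also have "\<dots> = (\<Sum>e\<in>X. 2 * (\<Sum>k<card I. load I h e - k))"
      by (intro sum.cong refl square_eq_sum_diff load_le fin)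
    also have "\<dots> = 2 * (\<Sum>k<card I. \<Sum>e\<in>X. load I h e - k)"
      by (subst sum.swap) (simp only: sum_distrib_left[symmetric])
    finally show ?thesis .
  qed
  have "(\<Sum>k<card I. \<Sum>e\<in>X. load I f e - k) \<le> (\<Sum>k<card I. \<Sum>e\<in>X. load I g e - k)"
    by (intro sum_mono major)
  with sq[of f, OF X(1)] sq[of g, OF X(2)] show ?thesis by linarith
qed

text \<open>Since \<open>q\<close> takes fewer than \<open>K\<close> values, some threshold between \<open>K * (k - 1)\<close> and \<open>K * k\<close>
  has no value immediately below it; the upper level set there is closed.\<close>

lemma potential_imp_square_sum_le:
  fixes q :: "'e \<Rightarrow> nat"
  assumes fin: "finite I" "finite X" and card: "card X < K"
    and g: "\<And>i. i \<in> I \<Longrightarrow> g i \<in> opts i"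
    and X: "\<And>i. i \<in> I \<Longrightarrow> f i \<in> opts i" "\<And>i. i \<in> I \<Longrightarrow> opts i \<subseteq> X"
    and steps: "\<And>i e. i \<in> I \<Longrightarrow> e \<in> opts i \<Longrightarrow> q (f i) \<le> q e + 1"
    and upper: "\<And>e. e \<in> X \<Longrightarrow> q e \<le> K * load I f e"
    and lower: "\<And>i. i \<in> I \<Longrightarrow> K * load I f (f i) \<le> q (f i) + K"
  shows "(\<Sum>e\<in>X. (load I f e)\<^sup>2) \<le> (\<Sum>e\<in>X. (load I g e)\<^sup>2)"
proof (rule closed_sets_imp_square_sum_le[OF fin, of g opts f])
  fix k
  \<comment> \<open>An edge to which nothing is charged has load 0, which extends
    \<open>lower\<close> to all edges.\<close>
  have lower': "K * load I f e \<le> q e + K" for e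
    using lower load_eq_0[of e f I] by (cases "e \<in> f ` I") auto
  show "\<exists>S. (\<forall>i\<in>I. f i \<in> S \<longrightarrow> opts i \<subseteq> S) \<and>
        (\<forall>e\<in>X. k < load I f e \<longrightarrow> e \<in> S) \<and> (\<forall>e\<in>X \<inter> S. k \<le> load I f e)"
  proof (cases k)
    case 0
    then show ?thesis by (intro exI[of _ UNIV]) auto
  next
    case (Suc l)
    have "\<exists>v\<in>{K * l..<K * k}. v \<notin> q ` X"
    proof (rule ccontr)
      assume "\<not> ?thesis"
      then have "{K * l..<K * k} \<subseteq> q ` X" by auto
      then have "card {K * l..<K * k} \<le> card (q ` X)"
        using fin by (intro card_mono) auto
      also have "\<dots> < K" using card card_image_le[OF fin(2), of q] by simp
      finally show False by (simp add: Suc)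
    qed
    then obtain v where v: "K * l \<le> v" "v < K * k" "v \<notin> q ` X" by auto
    show ?thesis
    proof (intro exI[of _ "{e. v < q e}"] conjI ballI impI subsetI)
      fix i e assume i: "i \<in> I" "f i \<in> {e. v < q e}" "e \<in> opts i"
      \<comment> \<open>The option's label is at least \<open>q (f i) - 1\<close>, hence at least
        \<open>v\<close>; as \<open>v\<close> is not a label, the inequality becomes strict.\<close>
      then have "v \<le> q e" "e \<in> X" using steps[of i e] X by auto
      with v(3) show "e \<in> {e. v < q e}" by (cases "q e = v") auto
    next
      fix e assume "k < load I f e"
      \<comment> \<open>A load strictly above \<open>k\<close> compensates for the \<open>K\<close>
        lost in \<open>lower'\<close>: \<open>q e\<close> is at least \<open>K * k\<close>, which
        exceeds \<open>v\<close>.\<close>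
      then have "K * (k + 1) \<le> K * load I f e" by (intro mult_le_mono) auto
      with lower'[of e] v show "e \<in> {e. v < q e}" by (simp add: algebra_simps)
    next
      fix e assume e: "e \<in> X \<inter> {e. v < q e}"
      then have "q e \<le> K * load I f e" "v < q e" using upper by auto
      with v(1) have "K * l < K * load I f e" by linarith
      then show "k \<le> load I f e" by (simp add: Suc)
    qed
  qed
qed (use g X in auto)

section \<open>Timed execution and rules for total correctness\<close>

fun loop_free :: "com \<Rightarrow> bool" where
  "loop_free (Seq c d) \<longleftrightarrow> loop_free c \<and> loop_free d"
| "loop_free (If b c d) \<longleftrightarrow> loop_free c \<and> loop_free d"
| "loop_free (While b c) \<longleftrightarrow> False"
| "loop_free _ \<longleftrightarrow> True"

text \<open>The values of \<open>exec\<close> and \<open>max_time\<close> on loops are junk.\<close>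

fun exec :: "com \<Rightarrow> state \<Rightarrow> state" where
  "exec SKIP s = s"
| "exec (Assign x a b) s = s(x := (s x)(aval a s := aval b s))"
| "exec (Seq c d) s = exec d (exec c s)"
| "exec (If b c d) s = (if bval b s then exec c s else exec d s)"
| "exec (While b c) s = s"

fun max_time :: "com \<Rightarrow> nat" where
  "max_time SKIP = 1"
| "max_time (Assign x a b) = 1 + atime a + atime b"
| "max_time (Seq c d) = max_time c + max_time d"
| "max_time (If b c d) = 1 + btime b + max (max_time c) (max_time d)"
| "max_time (While b c) = 0"

lemma runs_exec: "loop_free c \<Longrightarrow> \<exists>t \<le> max_time c. runs c s t (exec c s)"
proof (induction c arbitrary: s)
  case (Seq c d)
  then obtain t u where "t \<le> max_time c" "runs c s t (exec c s)"
    "u \<le> max_time d" "runs d (exec c s) u (exec d (exec c s))"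
    by (meson loop_free.simps(1))
  then show ?case by (intro exI[of _ "t + u"]) (auto intro: runs.intros)
next
  case (If b c d)
  show ?case
  proof (cases "bval b s")
    case True
    obtain t where "t \<le> max_time c" "runs c s t (exec c s)"
      using If by (meson loop_free.simps(2))
    with True runs.IfTrue[OF True, of c t "exec c s" d] show ?thesis
      by (intro exI[of _ "1 + btime b + t"]) simp
  next
    case False
    obtain t where "t \<le> max_time d" "runs d s t (exec d s)"
      using If by (meson loop_free.simps(2))
    with False runs.IfFalse[OF False, of d t "exec d s" c] show ?thesis
      by (intro exI[of _ "1 + btime b + t"]) simp
  qed
next
  case SKIP
  show ?case using runs.Skip[of s] by auto
next
  case (Assign x a b)
  show ?case using runs.Assign[of x a b s] by (simp only: exec.simps max_time.simps) blast
qed simp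

text \<open>Total correctness with a time budget. Keeping only an upper bound on the time allows
  branches of different cost to be treated alike.\<close>

definition reaches :: "com \<Rightarrow> state \<Rightarrow> nat \<Rightarrow> (state \<Rightarrow> bool) \<Rightarrow> bool" where
  "reaches c s t Q \<longleftrightarrow> (\<exists>u s'. runs c s u s' \<and> u \<le> t \<and> Q s')"

lemma reaches_exec: "loop_free c \<Longrightarrow> Q (exec c s) \<Longrightarrow> reaches c s (max_time c) Q"
  unfolding reaches_def using runs_exec by blast

lemma reaches_mono:
  "reaches c s t Q \<Longrightarrow> t \<le> u \<Longrightarrow> (\<And>s'. Q s' \<Longrightarrow> R s') \<Longrightarrow> reaches c s u R"
  unfolding reaches_def by (meson order_trans)

lemma reaches_Seq:
  assumes "reaches c s t Q" "\<And>s'. Q s' \<Longrightarrow> reaches d s' u R"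
  shows "reaches (Seq c d) s (t + u) R"
proof -
  obtain t' s' where 1: "runs c s t' s'" "t' \<le> t" "Q s'"
    using assms(1) by (auto simp: reaches_def)
  obtain u' s'' where 2: "runs d s' u' s''" "u' \<le> u" "R s''"
    using assms(2)[OF 1(3)] by (auto simp: reaches_def)
  show ?thesis unfolding reaches_def
    using 1 2 by (intro exI[of _ "t' + u'"] exI[of _ s'']) (auto intro: runs.Seq)
qed

text \<open>\<open>m\<close> bounds the number of remaining iterations, each costing one test and
  one body; the last summand pays for the final failing test.\<close>

lemma reaches_While:
  assumes "J s"
    and body: "\<And>s. J s \<Longrightarrow> bval b s \<Longrightarrow> reaches c s t (\<lambda>s'. J s' \<and> m s' < m s)"
  shows "reaches (While b c) s (m s * (1 + btime b + t) + (1 + btime b)) (\<lambda>s'. J s' \<and> \<not> bval b s')"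
  using assms(1)
proof (induction "m s" arbitrary: s rule: less_induct)
  case less
  show ?case
  proof (cases "bval b s")
    case False
    from runs.WhileFalse[OF this, of c] less.prems False show ?thesis
      unfolding reaches_def by (intro exI[of _ "1 + btime b"] exI[of _ s]) simp
  next
    case True
    obtain u s' where 1: "runs c s u s'" "u \<le> t" "J s'" "m s' < m s"
      using body[OF less.prems True] by (auto simp: reaches_def)
    obtain u' s'' where 2: "runs (While b c) s' u' s''"
      "u' \<le> m s' * (1 + btime b + t) + (1 + btime b)" "J s''" "\<not> bval b s''"
      using less.hyps[OF 1(4,3)] by (auto simp: reaches_def)
    \<comment> \<open>The drop of \<open>m\<close> by at least 1 pays for the test and body just
      executed.\<close>
    have "(m s' + 1) * (1 + btime b + t) \<le> m s * (1 + btime b + t)"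
      using 1(4) by (intro mult_le_mono) auto
    then have "1 + btime b + u + u' \<le> m s * (1 + btime b + t) + (1 + btime b)"
      using 1(2) 2(2) by (simp only: distrib_right mult_1)
    with runs.WhileTrue[OF True 1(1) 2(1)] 2 show ?thesis
      unfolding reaches_def by blast
  qed
qed

abbreviation scalar :: "vname \<Rightarrow> aexp" where
  "scalar x \<equiv> Rd x (N 0)"

abbreviation put :: "vname \<Rightarrow> aexp \<Rightarrow> com" where
  "put x a \<equiv> Assign x (N 0) a"

lemma reaches_put: "Q (s(x := (s x)(0 := c))) \<Longrightarrow> reaches (put x (N c)) s 3 Q"
  by (rule reaches_mono[OF reaches_exec]) auto

definition set_index :: "nat \<Rightarrow> state \<Rightarrow> state" where
  "set_index k s = s(''i'' := (s ''i'')(0 := k))"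

definition for_triangles :: "com \<Rightarrow> com" where
  "for_triangles c = Seq (put ''i'' (N 0))
     (While (Less (scalar ''i'') (scalar ''num_triangles''))
       (Seq c (put ''i'' (Plus (scalar ''i'') (N 1)))))"

text \<open>\<open>J k\<close> describes the state before pass \<open>k\<close>, with the counter
  already set. The 12 units per triangle are a loop test (6) and the increment (6); the 9 are the
  initialization (3) and the failing test (6).\<close>

lemma reaches_for_triangles:
  assumes "loop_free c" "s ''num_triangles'' 0 = n" "J 0 (set_index 0 s)"
    and body: "\<And>k s. \<lbrakk>k < n; J k s; s ''i'' 0 = k; s ''num_triangles'' 0 = n\<rbrakk> \<Longrightarrow>
      J (Suc k) (set_index (Suc k) (exec c s)) \<and>
      exec c s ''i'' 0 = k \<and> exec c s ''num_triangles'' 0 = n"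
  shows "reaches (for_triangles c) s (n * (max_time c + 12) + 9)
    (\<lambda>s'. J n s' \<and> s' ''num_triangles'' 0 = n)"
proof -
  define J' where "J' s \<longleftrightarrow> s ''i'' 0 \<le> n \<and> J (s ''i'' 0) s \<and> s ''num_triangles'' 0 = n" for s
  let ?b = "Less (scalar ''i'') (scalar ''num_triangles'')"
  let ?c = "Seq c (put ''i'' (Plus (scalar ''i'') (N 1)))"
  have step: "reaches ?c s (max_time ?c) (\<lambda>s'. J' s' \<and> n - s' ''i'' 0 < n - s ''i'' 0)"
    if "J' s" "bval ?b s" for s
  proof (rule reaches_exec)
    from that body[of "s ''i'' 0" s]
    show "J' (exec ?c s) \<and> n - exec ?c s ''i'' 0 < n - s ''i'' 0"
      by (auto simp: J'_def set_index_def)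
  qed (simp add: assms(1))
  have "reaches (for_triangles c) s (max_time (put ''i'' (N 0)) +
      ((n - set_index 0 s ''i'' 0) * (1 + btime ?b + max_time ?c) + (1 + btime ?b)))
      (\<lambda>s'. J' s' \<and> \<not> bval ?b s')"
    unfolding for_triangles_def
  proof (rule reaches_Seq)
    show "reaches (put ''i'' (N 0)) s (max_time (put ''i'' (N 0))) (\<lambda>s'. s' = set_index 0 s)"
      by (rule reaches_exec) (auto simp: set_index_def)
  next
    fix s' assume s': "s' = set_index 0 s"
    then have "J' s'" using assms(2,3) by (simp add: J'_def set_index_def)
    from reaches_While[of J' s' ?b ?c "max_time ?c" "\<lambda>s. n - s ''i'' 0", OF this step]
    show "reaches (While ?b ?c) s' ((n - set_index 0 s ''i'' 0) * (1 + btime ?b + max_time ?c) +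
      (1 + btime ?b)) (\<lambda>s'. J' s' \<and> \<not> bval ?b s')"
      unfolding s' .
  qed
  then show ?thesis
    by (rule reaches_mono) (auto simp: set_index_def algebra_simps J'_def)
qed

section \<open>The algorithm\<close>

text \<open>Triangle i is charged to its \<open>a i\<close>-th edge in the input table, and \<open>w e\<close> is K times the load
  of e, which avoids multiplication. Only cells of edges that occur in the table are
  initialized, because the number of edges is not bounded by the number of triangles.\<close>

definition triple :: "aexp \<Rightarrow> aexp" where
  "triple a = Plus a (Plus a a)"

lemma triple_simps [simp]: "aval (triple a) s = 3 * aval a s" "atime (triple a) = 2 + 3 * atime a"
  by (simp_all add: triple_def)

definition edge_of :: "aexp \<Rightarrow> aexp \<Rightarrow> aexp" where
  "edge_of i j = Rd ''table'' (Plus (triple i) j)"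

lemma edge_of_simps [simp]:
  "aval (edge_of i j) s = s ''table'' (3 * aval i s + aval j s)"
  "atime (edge_of i j) = 4 + 3 * atime i + atime j"
  by (simp_all add: edge_of_def)

text \<open>\<open>K\<close> starts at 1 and gains 3 per triangle, which replaces computing the
  product \<open>3 * n\<close>.\<close>

definition init_body :: com where
  "init_body = Seq (put ''K'' (Plus (scalar ''K'') (N 3)))
    (Seq (Assign ''q'' (edge_of (scalar ''i'') (N 0)) (N 0))
    (Seq (Assign ''q'' (edge_of (scalar ''i'') (N 1)) (N 0))
    (Seq (Assign ''q'' (edge_of (scalar ''i'') (N 2)) (N 0))
    (Seq (Assign ''w'' (edge_of (scalar ''i'') (N 0)) (N 0))
    (Seq (Assign ''w'' (edge_of (scalar ''i'') (N 1)) (N 0))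
         (Assign ''w'' (edge_of (scalar ''i'') (N 2)) (N 0)))))))"

definition assign_body :: com where
  "assign_body = Seq (Assign ''a'' (scalar ''i'') (N 0))
    (Assign ''w'' (edge_of (scalar ''i'') (N 0))
      (Plus (Rd ''w'' (edge_of (scalar ''i'') (N 0))) (scalar ''K'')))"

definition overfull :: "aexp \<Rightarrow> bexp" where
  "overfull e = Less (Plus (Rd ''q'' e) (scalar ''K'')) (Rd ''w'' e)"

text \<open>A later success overwrites an earlier one; any recorded pair allows a push.\<close>

definition try_option :: "nat \<Rightarrow> com" where
  "try_option j = If (Less (Rd ''q'' (edge_of (scalar ''i'') (N j))) (Rd ''q'' (scalar ''e'')))
    (Seq (put ''found'' (N 1)) (Seq (put ''fi'' (scalar ''i'')) (put ''fj'' (N j)))) SKIP"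

definition scan_body :: com where
  "scan_body = Seq (put ''e'' (edge_of (scalar ''i'') (Rd ''a'' (scalar ''i''))))
    (If (overfull (scalar ''e''))
      (Seq (put ''act'' (N 1)) (Seq (put ''cur'' (scalar ''e''))
        (Seq (try_option 0) (Seq (try_option 1) (try_option 2)))))
      SKIP)"

definition push :: com where
  "push = Seq (put ''e'' (edge_of (scalar ''fi'') (Rd ''a'' (scalar ''fi''))))
    (Seq (Assign ''w'' (scalar ''e'') (Minus (Rd ''w'' (scalar ''e'')) (scalar ''K'')))
    (Seq (Assign ''a'' (scalar ''fi'') (scalar ''fj''))
    (Seq (put ''e'' (edge_of (scalar ''fi'') (scalar ''fj'')))
         (Assign ''w'' (scalar ''e'') (Plus (Rd ''w'' (scalar ''e'')) (scalar ''K''))))))"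

definition relabel :: com where
  "relabel = Assign ''q'' (scalar ''cur'') (Plus (Rd ''q'' (scalar ''cur'')) (N 1))"

text \<open>Relabeling waits until no push is available, which keeps a charged label at most 1 above
  the labels of the triangle's other edges.\<close>

definition update :: com where
  "update = If (Less (N 0) (scalar ''found'')) push
    (If (Less (N 0) (scalar ''act'')) relabel SKIP)"

definition balance_round :: com where
  "balance_round = Seq (Seq (put ''act'' (N 0)) (put ''found'' (N 0)))
    (Seq (for_triangles scan_body) update)"

definition output_body :: com where
  "output_body = Seq (Assign ''x'' (triple (scalar ''i'')) (N 0))
    (Seq (Assign ''x'' (Plus (triple (scalar ''i'')) (N 1)) (N 0))
    (Seq (Assign ''x'' (Plus (triple (scalar ''i'')) (N 2)) (N 0))
         (Assign ''x'' (Plus (triple (scalar ''i''))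
           (Rd ''a'' (scalar ''i''))) (N 1))))"

text \<open>Setting \<open>act\<close> before the loop forces a first round.\<close>

definition balance :: com where
  "balance = Seq (put ''K'' (N 1)) (Seq (for_triangles init_body) (Seq (for_triangles assign_body)
    (Seq (put ''act'' (N 1)) (Seq (While (Less (N 0) (scalar ''act'')) balance_round)
      (for_triangles output_body)))))"


section \<open>Correctness and running time\<close>

lemma all_less_3: "(\<forall>j<3. P j) \<longleftrightarrow> P 0 \<and> P 1 \<and> P (2::nat)"
  by (simp add: numeral_3_eq_3 numeral_2_eq_2 All_less_Suc) blast

section \<open>The push-relabel method on an abstract table\<close>

locale triangle_table =
  fixes n :: nat and tab :: "nat \<Rightarrow> nat"
begin

text \<open>The table mentions at most \<open>3 * n\<close> edges; the extra 1 gives the strict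
  bound required by the pigeonhole argument.\<close>

definition K :: nat where "K = 3 * n + 1"

definition option :: "nat \<Rightarrow> nat \<Rightarrow> nat" where
  "option i j = tab (3 * i + j)"

definition chosen :: "(nat \<Rightarrow> nat) \<Rightarrow> nat \<Rightarrow> nat" where
  "chosen a i = option i (a i)"

definition Es :: "nat set" where
  "Es = (\<Union>i<n. option i ` {..<3})"

abbreviation ld :: "(nat \<Rightarrow> nat) \<Rightarrow> nat \<Rightarrow> nat" where
  "ld a \<equiv> load {..<n} (chosen a)"

lemma finite_Es [simp]: "finite Es"
  by (simp add: Es_def)

lemma card_Es: "card Es < K"
proof -
  have "card Es \<le> (\<Sum>i<n. card (option i ` {..<3::nat}))"
    unfolding Es_def by (rule card_UN_le) simp
  also have "\<dots> \<le> (\<Sum>i<n. 3)"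
    by (intro sum_mono) (metis card_image_le card_lessThan finite_lessThan)
  finally show ?thesis by (simp add: K_def)
qed

lemma option_in_Es: "i < n \<Longrightarrow> j < 3 \<Longrightarrow> option i j \<in> Es"
  by (auto simp: Es_def)

definition choice :: "(nat \<Rightarrow> nat) \<Rightarrow> bool" where
  "choice a \<longleftrightarrow> (\<forall>i<n. a i < 3)"

lemma chosen_in_Es: "choice a \<Longrightarrow> i < n \<Longrightarrow> chosen a i \<in> Es"
  by (simp add: chosen_def choice_def option_in_Es)

definition valid :: "(nat \<Rightarrow> nat) \<Rightarrow> (nat \<Rightarrow> nat) \<Rightarrow> (nat \<Rightarrow> nat) \<Rightarrow> bool" where
  "valid a q w \<longleftrightarrow> choice a \<and>
     (\<forall>i<n. \<forall>j<3. q (chosen a i) \<le> q (option i j) + 1) \<and>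
     (\<forall>e\<in>Es. q e \<le> K * ld a e) \<and> (\<forall>e\<in>Es. w e = K * ld a e)"

text \<open>The last hypothesis is the halting condition, that no charged edge is overfull. Since
  \<open>w\<close> tracks \<open>K * ld a\<close>, it supplies the lower bound on the
  labels.\<close>

lemma valid_imp_optimal:
  assumes "valid a q w" "choice b" "\<And>i. i < n \<Longrightarrow> w (chosen a i) \<le> q (chosen a i) + K"
  shows "(\<Sum>e\<in>Es. (ld a e)\<^sup>2) \<le> (\<Sum>e\<in>Es. (ld b e)\<^sup>2)"
proof (rule potential_imp_square_sum_le[where K = K and q = q and opts = "\<lambda>i. option i ` {..<3}"])
  fix i assume i: "i \<in> {..<n}"
  then show "chosen a i \<in> option i ` {..<3}" "chosen b i \<in> option i ` {..<3}"
    using assms by (auto simp: valid_def choice_def chosen_def)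
  show "option i ` {..<3} \<subseteq> Es" using i by (auto simp: Es_def)
  show "q (chosen a i) \<le> q e + 1" if "e \<in> option i ` {..<3}" for e
    using i that assms(1) by (auto simp: valid_def)
  show "K * ld a (chosen a i) \<le> q (chosen a i) + K"
    using i assms(1) assms(3)[of i] chosen_in_Es[of a i] by (auto simp: valid_def)
qed (use card_Es assms in \<open>auto simp: valid_def\<close>)

text \<open>The weight \<open>n + 1\<close> makes the drop caused by one relabeling exceed the rise
  of the second sum, which is at most \<open>n\<close>.\<close>

definition potential :: "(nat \<Rightarrow> nat) \<Rightarrow> (nat \<Rightarrow> nat) \<Rightarrow> nat" where
  "potential a q = (n + 1) * (K * n - (\<Sum>e\<in>Es. q e)) + (\<Sum>i<n. q (chosen a i))"

text \<open>Each triangle contributes at most \<open>K\<close> to the sum of the bounds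
  \<open>K * ld a e\<close>. Hence the subtraction in \<open>potential\<close> is never
  truncated.\<close>

lemma sum_labels_le: "valid a q w \<Longrightarrow> (\<Sum>e\<in>Es. q e) \<le> K * n"
proof -
  assume v: "valid a q w"
  have "(\<Sum>e\<in>Es. q e) \<le> (\<Sum>e\<in>Es. K * ld a e)"
    using v by (intro sum_mono) (simp add: valid_def)
  also have "\<dots> = K * card {i \<in> {..<n}. chosen a i \<in> Es}"
    by (simp add: sum_load sum_distrib_left[symmetric])
  also have "\<dots> \<le> K * card {..<n}"
    by (intro mult_le_mono card_mono) auto
  finally show ?thesis by simp
qed

lemma chosen_upd: "chosen (a(i := j)) = (chosen a)(i := option i j)"
  by (auto simp: chosen_def)

lemma push_valid:
  assumes v: "valid a q w" and i: "i < n" and j: "j < 3"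
    and over: "q (chosen a i) + K < w (chosen a i)"
    and low: "q (option i j) < q (chosen a i)"
  defines "w1 \<equiv> w(chosen a i := w (chosen a i) - K)"
  shows "valid (a(i := j)) q (w1(option i j := w1 (option i j) + K))"
    and "potential (a(i := j)) q < potential a q"
proof -
  let ?e = "chosen a i" and ?f = "option i j"
  have ne: "?f \<noteq> ?e" using low by auto
  have e: "?e \<in> Es" using v i by (auto simp: valid_def intro: chosen_in_Es)
  have ld: "ld (a(i := j)) e' = (if e' = ?f then ld a e' + 1 else if e' = ?e then ld a e' - 1 else ld a e')" for e'
    unfolding chosen_upd using i ne by (simp add: load_upd)
  have Ke: "K * (ld a ?e - 1) = w ?e - K" "w ?e = K * ld a ?e"
    using v e by (auto simp: valid_def algebra_simps)
  \<comment> \<open>Triangle \<open>i\<close> is now charged to a smaller label, so its bound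
    persists; the other triangles keep their edges and labels.\<close>
  have near: "q (chosen (a(i := j)) i') \<le> q (option i' j') + 1" if "i' < n" "j' < 3" for i' j'
  proof (cases "i' = i")
    case True
    have "q ?e \<le> q (option i j') + 1" using v i that by (auto simp: valid_def)
    then show ?thesis using True low by (simp add: chosen_upd)
  next
    case False
    then show ?thesis using v that by (simp add: chosen_upd valid_def)
  qed
  \<comment> \<open>Only the old edge loses load, by 1; being overfull, it has more than
    \<open>K\<close> to spare.\<close>
  have upper: "q e' \<le> K * ld (a(i := j)) e'" if "e' \<in> Es" for e'
  proof -
    have "q e' \<le> K * ld a e'" using v that by (simp add: valid_def)
    then show ?thesis unfolding ld using Ke over ne by auto
  qed
  have w: "(w1(?f := w1 ?f + K)) e' = K * ld (a(i := j)) e'" if "e' \<in> Es" for e'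
  proof -
    have "w e' = K * ld a e'" using v that by (simp add: valid_def)
    then show ?thesis unfolding ld w1_def using Ke ne by auto
  qed
  have "choice (a(i := j))" using v j by (simp add: valid_def choice_def)
  with near upper w show "valid (a(i := j)) q (w1(?f := w1 ?f + K))"
    by (simp only: valid_def) blast
  \<comment> \<open>The charged label of triangle \<open>i\<close> falls strictly, the others stay,
    and the first term of the potential depends only on \<open>q\<close>.\<close>
  have "(\<Sum>k<n. q (chosen (a(i := j)) k)) < (\<Sum>k<n. q (chosen a k))"
    using i low by (intro sum_strict_mono_ex1) (auto simp: chosen_upd)
  then show "potential (a(i := j)) q < potential a q"
    by (simp add: potential_def)
qed

lemma relabel_valid:
  assumes v: "valid a q w" and i: "i < n"
    and over: "q (chosen a i) + K < w (chosen a i)"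
    and stuck: "\<And>k j. \<lbrakk>k < n; j < 3; q (chosen a k) + K < w (chosen a k)\<rbrakk> \<Longrightarrow>
      q (chosen a k) \<le> q (option k j)"
  defines "q' \<equiv> q(chosen a i := q (chosen a i) + 1)"
  shows "valid a q' w" and "potential a q' < potential a q"
proof -
  let ?e = "chosen a i"
  have e: "?e \<in> Es" using v i by (auto simp: valid_def intro: chosen_in_Es)
  \<comment> \<open>A triangle charged to the raised edge had no option with a smaller label, so its
    gap becomes at most 1. For other triangles the raise can only lift the right-hand side.\<close>
  have near: "q' (chosen a k) \<le> q' (option k j) + 1" if "k < n" "j < 3" for k j
  proof (cases "chosen a k = ?e")
    case True
    then have "q (chosen a k) \<le> q (option k j)" using stuck[OF that] over by simp
    with True show ?thesis by (auto simp: q'_def)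
  next
    case False
    have "q (chosen a k) \<le> q (option k j) + 1" using v that by (auto simp: valid_def)
    with False show ?thesis by (auto simp: q'_def)
  qed
  \<comment> \<open>Overfullness leaves room of more than \<open>K\<close>, hence for one
    increment.\<close>
  have "q' e' \<le> K * ld a e'" if "e' \<in> Es" for e'
    using v that over e by (auto simp: valid_def q'_def K_def)
  with near v show v': "valid a q' w"
    by (simp add: valid_def)
  have "(\<Sum>e\<in>Es. q' e) = (\<Sum>e\<in>Es. q e) + 1"
    using e by (simp add: q'_def sum.remove[of Es ?e])
  \<comment> \<open>The bound for the new labels shows that the difference truly decreases, instead
    of having been 0 already.\<close>
  with sum_labels_le[OF v'] obtain r where
    r: "K * n - (\<Sum>e\<in>Es. q e) = Suc r" "K * n - (\<Sum>e\<in>Es. q' e) = r"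
    by (metis Suc_diff_Suc add.commute less_eq_Suc_le plus_1_eq_Suc)
  have "(\<Sum>k<n. q' (chosen a k)) \<le> (\<Sum>k<n. q (chosen a k) + 1)"
    by (intro sum_mono) (simp add: q'_def)
  also have "\<dots> = (\<Sum>k<n. q (chosen a k)) + n"
    by (simp only: sum.distrib) simp
  finally show "potential a q' < potential a q"
    by (simp add: potential_def r)
qed

section \<open>Program states and the main loop\<close>

definition loaded :: "state \<Rightarrow> bool" where
  "loaded s \<longleftrightarrow> s ''num_triangles'' 0 = n \<and> s ''table'' = tab"

definition Inv :: "state \<Rightarrow> bool" where
  "Inv s \<longleftrightarrow> loaded s \<and> s ''K'' 0 = K \<and> valid (s ''a'') (s ''q'') (s ''w'')"

definition over :: "state \<Rightarrow> nat \<Rightarrow> bool" where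
  "over s i \<longleftrightarrow> s ''q'' (chosen (s ''a'') i) + K < s ''w'' (chosen (s ''a'') i)"

definition pushable :: "state \<Rightarrow> nat \<Rightarrow> nat \<Rightarrow> bool" where
  "pushable s i j \<longleftrightarrow> over s i \<and> s ''q'' (option i j) < s ''q'' (chosen (s ''a'') i)"

text \<open>Scanning writes only scratch cells, so its findings can be stated about the state
  \<open>s0\<close> before the scan.\<close>

definition same :: "state \<Rightarrow> state \<Rightarrow> bool" where
  "same s0 s \<longleftrightarrow> loaded s \<and> s ''K'' 0 = K \<and>
     s ''a'' = s0 ''a'' \<and> s ''q'' = s0 ''q'' \<and> s ''w'' = s0 ''w''"

text \<open>Once \<open>found\<close> is set, only the recorded pair matters; the set
  \<open>P\<close> of pairs tested matters while the search is unsuccessful.\<close>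

definition tested :: "state \<Rightarrow> (nat \<times> nat) set \<Rightarrow> state \<Rightarrow> bool" where
  "tested s0 P s \<longleftrightarrow> (if s ''found'' 0 = 0 then \<forall>(i, j)\<in>P. \<not> pushable s0 i j
     else s ''fi'' 0 < n \<and> s ''fj'' 0 < 3 \<and> pushable s0 (s ''fi'' 0) (s ''fj'' 0))"

definition scanned :: "state \<Rightarrow> nat \<Rightarrow> state \<Rightarrow> bool" where
  "scanned s0 k s \<longleftrightarrow> same s0 s \<and> tested s0 ({..<k} \<times> {..<3}) s \<and>
     (if s ''act'' 0 = 0 then \<forall>i<k. \<not> over s0 i
      else \<exists>i<k. s ''cur'' 0 = chosen (s0 ''a'') i \<and> over s0 i)"

lemma try_option_step:
  assumes "same s0 s" "s ''i'' 0 = k" "s ''e'' 0 = chosen (s0 ''a'') k" "over s0 k" "k < n" "j < 3"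
    and "tested s0 P s"
  shows "same s0 (exec (try_option j) s) \<and> tested s0 (insert (k, j) P) (exec (try_option j) s) \<and>
    (\<forall>x\<in>{''i'', ''e'', ''act'', ''cur'', ''num_triangles''}. exec (try_option j) s x 0 = s x 0)"
proof (cases "pushable s0 k j")
  case True
  with assms have "exec (try_option j) s = s(''found'' := (s ''found'')(0 := 1),
      ''fi'' := (s ''fi'')(0 := k), ''fj'' := (s ''fj'')(0 := j))"
    by (simp add: try_option_def pushable_def same_def loaded_def option_def)
  with assms True show ?thesis by (simp add: same_def loaded_def tested_def)
next
  case False
  with assms have "exec (try_option j) s = s"
    by (simp add: try_option_def pushable_def same_def loaded_def option_def)
  with assms False show ?thesis by (auto simp: tested_def)
qed

lemma scan_step:
  assumes "scanned s0 k s" "s ''i'' 0 = k" "k < n"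
  shows "scanned s0 (Suc k) (set_index (Suc k) (exec scan_body s)) \<and> exec scan_body s ''i'' 0 = k
    \<and> exec scan_body s ''num_triangles'' 0 = n"
proof -
  let ?c = "chosen (s0 ''a'') k" and ?P = "{..<k} \<times> {..<3::nat}"
  let ?s = "s(''e'' := (s ''e'')(0 := ?c))"
  have same: "same s0 s" and tested: "tested s0 ?P s"
    using assms by (auto simp: scanned_def)
  have P: "{..<Suc k} \<times> {..<3} = insert (k, 2) (insert (k, 1) (insert (k, 0) ?P))"
    by auto
  show ?thesis
  proof (cases "over s0 k")
    case False
    have s': "exec scan_body s = ?s"
      using False same assms(2)
      by (simp add: scan_body_def overfull_def over_def same_def loaded_def chosen_def option_def)
    \<comment> \<open>A triangle whose charged edge is not overfull admits no push, so its three
      pairs count as tested although the tests are skipped.\<close>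
    have "tested s0 ({..<Suc k} \<times> {..<3}) s"
      using tested False unfolding P by (auto simp: tested_def pushable_def)
    with assms same False show ?thesis unfolding s'
      by (auto simp: scanned_def same_def loaded_def tested_def set_index_def less_Suc_eq)
  next
    case True
    define s1 where "s1 = ?s(''act'' := (s ''act'')(0 := 1), ''cur'' := (s ''cur'')(0 := ?c))"
    have s': "exec scan_body s = exec (try_option 2) (exec (try_option 1) (exec (try_option 0) s1))"
      using True same assms(2) unfolding s1_def
      by (simp add: scan_body_def overfull_def over_def same_def loaded_def chosen_def option_def)
    have s1: "same s0 s1" "tested s0 ?P s1" "s1 ''i'' 0 = k" "s1 ''e'' 0 = ?c"
      "s1 ''act'' 0 = 1" "s1 ''cur'' 0 = ?c"
      using same tested assms(2) by (simp_all add: s1_def same_def loaded_def tested_def)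
    note step = try_option_step[OF _ _ _ True assms(3)]
    define s2 where "s2 = exec (try_option 0) s1"
    define s3 where "s3 = exec (try_option 1) s2"
    have s2: "same s0 s2" "tested s0 (insert (k, 0) ?P) s2" "s2 ''i'' 0 = k" "s2 ''e'' 0 = ?c"
      "s2 ''act'' 0 = 1" "s2 ''cur'' 0 = ?c"
      using step[of s1 0 ?P] s1 unfolding s2_def by simp_all
    have s3: "same s0 s3" "tested s0 (insert (k, 1) (insert (k, 0) ?P)) s3" "s3 ''i'' 0 = k"
      "s3 ''e'' 0 = ?c" "s3 ''act'' 0 = 1" "s3 ''cur'' 0 = ?c"
      using step[of s2 1] s2 unfolding s3_def by simp_all
    have "same s0 (exec scan_body s) \<and> tested s0 ({..<Suc k} \<times> {..<3}) (exec scan_body s) \<and>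
       exec scan_body s ''i'' 0 = k \<and> exec scan_body s ''act'' 0 = 1 \<and> exec scan_body s ''cur'' 0 = ?c"
      unfolding P s' s2_def[symmetric] s3_def[symmetric] using step[of s3 2] s3 by simp
    with True show ?thesis
      by (auto simp: scanned_def same_def loaded_def tested_def set_index_def)
  qed
qed

lemma reaches_scan:
  assumes "Inv s" "s ''act'' 0 = 0" "s ''found'' 0 = 0"
  shows "reaches (for_triangles scan_body) s (n * (max_time scan_body + 12) + 9)
    (\<lambda>s'. scanned s n s')"
proof (rule reaches_mono[OF reaches_for_triangles[where J = "scanned s" and n = n]])
  show "loop_free scan_body" by (simp add: scan_body_def try_option_def)
  show "s ''num_triangles'' 0 = n" using assms by (simp add: Inv_def loaded_def)
  show "scanned s 0 (set_index 0 s)"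
    using assms by (simp add: scanned_def same_def tested_def set_index_def Inv_def loaded_def)
next
  fix k t assume "k < n" "scanned s k t" "t ''i'' 0 = k"
  then show "scanned s (Suc k) (set_index (Suc k) (exec scan_body t)) \<and>
      exec scan_body t ''i'' 0 = k \<and> exec scan_body t ''num_triangles'' 0 = n"
    by (intro scan_step)
qed auto

text \<open>Push and relabel both lower the potential and leave \<open>act\<close> alone, so the
  loop guard still reports the outcome of the scan.\<close>

lemma update_step:
  assumes "Inv s0" "scanned s0 n s"
  shows "if s ''act'' 0 = 0 \<and> s ''found'' 0 = 0 then exec update s = s
    else Inv (exec update s) \<and> exec update s ''act'' 0 = s ''act'' 0 \<and>
      potential (exec update s ''a'') (exec update s ''q'') < potential (s0 ''a'') (s0 ''q'')"
proof -
  let ?a = "s0 ''a''" and ?q = "s0 ''q''" and ?w = "s0 ''w''"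
  have v: "valid ?a ?q ?w" using assms by (simp add: Inv_def)
  have s: "loaded s" "s ''K'' 0 = K" "s ''a'' = ?a" "s ''q'' = ?q" "s ''w'' = ?w"
    using assms by (auto simp: scanned_def same_def)
  show ?thesis
  proof (cases "s ''found'' 0 = 0")
    case False
    define i j where "i = s ''fi'' 0" and "j = s ''fj'' 0"
    have ij: "i < n" "j < 3" "?q (chosen ?a i) + K < ?w (chosen ?a i)"
      "?q (option i j) < ?q (chosen ?a i)"
      using assms(2) False s by (auto simp: scanned_def tested_def pushable_def over_def i_def j_def)
    let ?s = "exec update s"
    let ?w1 = "?w(chosen ?a i := ?w (chosen ?a i) - K)"
    have "loaded ?s \<and> ?s ''K'' 0 = K \<and> ?s ''act'' 0 = s ''act'' 0 \<and> ?s ''a'' = ?a(i := j) \<and> ?s ''q'' = ?q \<and>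
      ?s ''w'' = ?w1(option i j := ?w1 (option i j) + K)"
      using s False by (simp add: update_def push_def loaded_def i_def j_def chosen_def option_def)
    with push_valid[OF v ij] False show ?thesis by (simp add: Inv_def)
  next
    case found: True
    show ?thesis
    proof (cases "s ''act'' 0 = 0")
      case True
      with found show ?thesis by (simp add: update_def)
    next
      case False
      then obtain i where i: "i < n" "s ''cur'' 0 = chosen ?a i"
        "?q (chosen ?a i) + K < ?w (chosen ?a i)"
        using assms(2) s by (auto simp: scanned_def over_def)
      have stuck: "?q (chosen ?a k) \<le> ?q (option k j)"
        if "k < n" "j < 3" "?q (chosen ?a k) + K < ?w (chosen ?a k)" for k j
        using assms(2) found s that by (force simp: scanned_def tested_def pushable_def over_def)
      let ?s = "exec update s"
      have "loaded ?s \<and> ?s ''K'' 0 = K \<and> ?s ''act'' 0 = s ''act'' 0 \<and> ?s ''a'' = ?a \<and> ?s ''w'' = ?w \<and>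
        ?s ''q'' = ?q(chosen ?a i := ?q (chosen ?a i) + 1)"
        using s found False i(2) by (simp add: update_def relabel_def loaded_def)
      moreover have "valid ?a (?q(chosen ?a i := ?q (chosen ?a i) + 1)) ?w"
        by (rule relabel_valid(1)[OF v i(1,3)], rule stuck)
      moreover have "potential ?a (?q(chosen ?a i := ?q (chosen ?a i) + 1)) < potential ?a ?q"
        by (rule relabel_valid(2)[OF v i(1,3)], rule stuck)
      ultimately show ?thesis using False by (simp add: Inv_def)
    qed
  qed
qed

definition round_time :: nat where
  "round_time = 6 + (n * (max_time scan_body + 12) + 9 + max_time update)"

lemma reaches_round:
  assumes "Inv s"
  shows "reaches balance_round s round_time (\<lambda>s'. Inv s' \<and>
    (if s' ''act'' 0 = 0 then \<forall>i<n. \<not> over s' i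
     else potential (s' ''a'') (s' ''q'') < potential (s ''a'') (s ''q'')))"
proof -
  let ?s0 = "exec (Seq (put ''act'' (N 0)) (put ''found'' (N 0))) s"
  have s0: "Inv ?s0" "?s0 ''act'' 0 = 0" "?s0 ''found'' 0 = 0" "?s0 ''a'' = s ''a''" "?s0 ''q'' = s ''q''"
    using assms by (auto simp: Inv_def loaded_def)
  have start: "reaches (Seq (put ''act'' (N 0)) (put ''found'' (N 0))) s 6 (\<lambda>s'. s' = ?s0)"
    by (rule reaches_mono[OF reaches_exec[where Q = "\<lambda>s'. s' = ?s0"]]) auto
  have finish: "reaches update s1 (max_time update) (\<lambda>s'. Inv s' \<and>
      (if s' ''act'' 0 = 0 then \<forall>i<n. \<not> over s' i
       else potential (s' ''a'') (s' ''q'') < potential (s ''a'') (s ''q'')))"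
    if s1: "scanned ?s0 n s1" for s1
  proof (rule reaches_exec)
    show "loop_free update" by (simp add: update_def push_def relabel_def)
    have same: "same ?s0 s1" using s1 by (simp add: scanned_def)
    show "Inv (exec update s1) \<and> (if exec update s1 ''act'' 0 = 0 then \<forall>i<n. \<not> over (exec update s1) i
       else potential (exec update s1 ''a'') (exec update s1 ''q'') < potential (s ''a'') (s ''q''))"
    proof (cases "s1 ''act'' 0 = 0")
      case True
      then have none: "\<forall>i<n. \<not> over ?s0 i" using s1 by (simp add: scanned_def del: exec.simps)
      \<comment> \<open>A push requires an overfull edge, so none was recorded;
        \<open>update\<close> then does nothing and the verdict of the scan holds for the final
        state.\<close>
      then have "s1 ''found'' 0 = 0"
        using s1 by (auto simp only: scanned_def tested_def pushable_def split: if_splits)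
      with update_step[OF s0(1) s1] True have "exec update s1 = s1" by simp
      moreover have "Inv s1" using s0(1) same by (simp add: Inv_def same_def)
      moreover have "\<forall>i<n. \<not> over s1 i" using none same by (simp add: over_def same_def)
      ultimately show ?thesis using True by simp
    next
      case False
      with update_step[OF s0(1) s1] s0(4,5) show ?thesis by simp
    qed
  qed
  have "reaches balance_round s (6 + (n * (max_time scan_body + 12) + 9 + max_time update)) (\<lambda>s'. Inv s' \<and>
    (if s' ''act'' 0 = 0 then \<forall>i<n. \<not> over s' i
     else potential (s' ''a'') (s' ''q'') < potential (s ''a'') (s ''q'')))"
    unfolding balance_round_def
  proof (rule reaches_Seq[OF start], rule reaches_Seq)
    fix s' assume "s' = ?s0"
    with reaches_scan[OF s0(1-3)]
    show "reaches (for_triangles scan_body) s' (n * (max_time scan_body + 12) + 9) (scanned ?s0 n)"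
      by (simp only:)
  qed (rule finish)
  then show ?thesis by (simp only: round_time_def)
qed

text \<open>\<open>(n + 1) * (K * n)\<close> is the potential when all labels are 0; the added 1 is
  for the last round, which finds no overfull edge. The 5 units are the loop test.\<close>

definition main_time :: nat where
  "main_time = ((n + 1) * (K * n) + 1) * (5 + round_time) + 5"

lemma reaches_main:
  assumes "Inv s" "s ''act'' 0 = 1" "\<And>e. e \<in> Es \<Longrightarrow> s ''q'' e = 0"
  shows "reaches (While (Less (N 0) (scalar ''act'')) balance_round) s main_time
    (\<lambda>s'. Inv s' \<and> (\<forall>i<n. \<not> over s' i))"
proof -
  let ?J = "\<lambda>s. Inv s \<and> (s ''act'' 0 = 0 \<longrightarrow> (\<forall>i<n. \<not> over s i))"
  \<comment> \<open>The last round clears \<open>act\<close> without changing the labels or charges;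
    the extra 1 while \<open>act\<close> is nonzero makes it count as progress.\<close>
  let ?m = "\<lambda>s. if s ''act'' 0 = 0 then 0 else potential (s ''a'') (s ''q'') + 1"
  have body: "reaches balance_round s round_time (\<lambda>s'. ?J s' \<and> ?m s' < ?m s)"
    if "?J s" "bval (Less (N 0) (scalar ''act'')) s" for s
    by (rule reaches_mono[OF reaches_round]) (use that in \<open>auto split: if_splits\<close>)
  have "\<And>i. i < n \<Longrightarrow> chosen (s ''a'') i \<in> Es"
    using assms(1) by (auto simp: Inv_def valid_def intro: chosen_in_Es)
  then have m: "?m s = (n + 1) * (K * n) + 1"
    using assms(2,3) by (simp add: potential_def)
  let ?b = "Less (N 0) (scalar ''act'')"
  have "?J s" using assms by simp
  then have "reaches (While ?b balance_round) s
      (?m s * (1 + btime ?b + round_time) + (1 + btime ?b)) (\<lambda>s'. ?J s' \<and> \<not> bval ?b s')"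
    by (rule reaches_While[where J = ?J and m = ?m and t = round_time, OF _ body])
  moreover have "?m s * (1 + btime ?b + round_time) + (1 + btime ?b) = main_time"
    unfolding m main_time_def by (simp add: algebra_simps)
  ultimately show ?thesis
    by (elim reaches_mono) simp_all
qed

section \<open>The remaining phases and the whole program\<close>

lemma reaches_init:
  assumes "loaded s" "s ''K'' 0 = 1"
  shows "reaches (for_triangles init_body) s (n * (max_time init_body + 12) + 9)
    (\<lambda>s'. loaded s' \<and> s' ''K'' 0 = K \<and> (\<forall>e\<in>Es. s' ''q'' e = 0 \<and> s' ''w'' e = 0))"
proof -
  define J where "J k s \<longleftrightarrow> loaded s \<and> s ''K'' 0 = 3 * k + 1 \<and>
    (\<forall>i<k. \<forall>j<3. s ''q'' (option i j) = 0 \<and> s ''w'' (option i j) = 0)" for k s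
  have "reaches (for_triangles init_body) s (n * (max_time init_body + 12) + 9)
    (\<lambda>s'. J n s' \<and> s' ''num_triangles'' 0 = n)"
  proof (rule reaches_for_triangles)
    fix k s assume J: "J k s" and k: "s ''i'' 0 = k"
    define c where "c = (\<lambda>f :: nat \<Rightarrow> nat. f(option k 0 := 0, option k 1 := 0, option k 2 := 0))"
    let ?s = "exec init_body s"
    have "?s = s(''K'' := (s ''K'')(0 := s ''K'' 0 + 3), ''q'' := c (s ''q''), ''w'' := c (s ''w''))"
      using J k by (simp add: init_body_def c_def option_def loaded_def J_def)
    \<comment> \<open>The first alternative covers edges of earlier triangles: they are already 0,
      and clearing more cells keeps them so.\<close>
    moreover have "c f e = 0" if "f e = 0 \<or> e \<in> option k ` {..<3}" for f e
      using that by (auto simp: c_def all_less_3 lessThan_def numeral_3_eq_3 numeral_2_eq_2 less_Suc_eq)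
    ultimately show "J (Suc k) (set_index (Suc k) ?s) \<and> ?s ''i'' 0 = k \<and> ?s ''num_triangles'' 0 = n"
      using J k by (auto simp: J_def loaded_def set_index_def less_Suc_eq)
  qed (use assms in \<open>auto simp: init_body_def J_def loaded_def set_index_def\<close>)
  then show ?thesis
    by (rule reaches_mono) (auto simp: J_def K_def Es_def)
qed

lemma reaches_assign:
  assumes "loaded s" "s ''K'' 0 = K" "\<forall>e\<in>Es. s ''q'' e = 0 \<and> s ''w'' e = 0"
  shows "reaches (for_triangles assign_body) s (n * (max_time assign_body + 12) + 9)
    (\<lambda>s'. Inv s' \<and> (\<forall>e\<in>Es. s' ''q'' e = 0))"
proof -
  define J where "J k s \<longleftrightarrow> loaded s \<and> s ''K'' 0 = K \<and> (\<forall>e\<in>Es. s ''q'' e = 0) \<and>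
    (\<forall>i<k. s ''a'' i = 0) \<and> (\<forall>e\<in>Es. s ''w'' e = K * load {..<k} (\<lambda>i. option i 0) e)" for k s
  have "reaches (for_triangles assign_body) s (n * (max_time assign_body + 12) + 9)
    (\<lambda>s'. J n s' \<and> s' ''num_triangles'' 0 = n)"
  proof (rule reaches_for_triangles)
    fix k s assume J: "J k s" and k: "s ''i'' 0 = k"
    let ?s = "exec assign_body s"
    have "?s = s(''a'' := (s ''a'')(k := 0), ''w'' := (s ''w'')(option k 0 := s ''w'' (option k 0) + K))"
      using J k by (simp add: assign_body_def option_def loaded_def J_def)
    then show "J (Suc k) (set_index (Suc k) ?s) \<and> ?s ''i'' 0 = k \<and> ?s ''num_triangles'' 0 = n"
      using J k by (auto simp: J_def loaded_def set_index_def less_Suc_eq load_Suc)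
  qed (use assms in \<open>auto simp: assign_body_def J_def loaded_def set_index_def load_def\<close>)
  then show ?thesis
  proof (rule reaches_mono)
    fix s' assume "J n s' \<and> s' ''num_triangles'' 0 = n"
    then have J: "J n s'" by simp
    have ch: "choice (s' ''a'')" using J by (simp add: J_def choice_def)
    have "ld (s' ''a'') e = load {..<n} (\<lambda>i. option i 0) e" for e
      using J by (intro load_cong) (simp add: chosen_def J_def)
    \<comment> \<open>With all labels 0, both label conditions in \<open>valid\<close> hold
      trivially.\<close>
    with ch J show "Inv s' \<and> (\<forall>e\<in>Es. s' ''q'' e = 0)"
      by (auto simp: Inv_def valid_def J_def chosen_in_Es)
  qed simp
qed

lemma reaches_output:
  assumes "loaded s" "choice (s ''a'')"
  shows "reaches (for_triangles output_body) s (n * (max_time output_body + 12) + 9)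
    (\<lambda>s'. \<forall>i<n. \<forall>j<3. s' ''x'' (3 * i + j) = of_bool (j = s ''a'' i))"
proof -
  define J where "J k s' \<longleftrightarrow> loaded s' \<and> s' ''a'' = s ''a'' \<and>
    (\<forall>i<k. \<forall>j<3. s' ''x'' (3 * i + j) = of_bool (j = s ''a'' i))" for k s'
  have "reaches (for_triangles output_body) s (n * (max_time output_body + 12) + 9)
    (\<lambda>s'. J n s' \<and> s' ''num_triangles'' 0 = n)"
  proof (rule reaches_for_triangles)
    fix k t assume J: "J k t" and k: "t ''i'' 0 = k" "k < n"
    let ?s = "exec output_body t"
    define x where
      "x = (t ''x'')(3 * k := 0, 3 * k + 1 := 0, 3 * k + 2 := 0, 3 * k + s ''a'' k := 1)"
    have s': "?s = t(''x'' := x)"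
      using J k by (simp add: output_body_def J_def x_def)
    have "x (3 * i + j) = of_bool (j = s ''a'' i)" if "i < Suc k" "j < 3" for i j
    proof (cases "i < k")
      case True
      \<comment> \<open>The blocks of three cells belonging to different triangles are disjoint, so
        earlier output survives.\<close>
      then have "3 * i + j < 3 * k" using that by linarith
      then have "x (3 * i + j) = t ''x'' (3 * i + j)" by (simp add: x_def)
      with True that J show ?thesis by (simp add: J_def)
    next
      case False
      then have "i = k" "j = 0 \<or> j = 1 \<or> j = 2" using that by auto
      then show ?thesis by (auto simp: x_def)
    qed
    with J k show "J (Suc k) (set_index (Suc k) ?s) \<and> ?s ''i'' 0 = k \<and> ?s ''num_triangles'' 0 = n"
      unfolding s' by (simp add: J_def loaded_def set_index_def)
  qed (use assms in \<open>auto simp: output_body_def J_def loaded_def set_index_def\<close>)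
  then show ?thesis
    by (rule reaches_mono) (auto simp: J_def)
qed

definition total_time :: nat where
  "total_time = 3 + ((n * (max_time init_body + 12) + 9) + ((n * (max_time assign_body + 12) + 9) +
     (3 + (main_time + (n * (max_time output_body + 12) + 9)))))"

lemma reaches_balance:
  assumes "loaded s"
  shows "reaches balance s total_time (\<lambda>s'. \<exists>a. choice a \<and>
    (\<forall>b. choice b \<longrightarrow> (\<Sum>e\<in>Es. (ld a e)\<^sup>2) \<le> (\<Sum>e\<in>Es. (ld b e)\<^sup>2)) \<and>
    (\<forall>i<n. \<forall>j<3. s' ''x'' (3 * i + j) = of_bool (j = a i)))"
  unfolding balance_def total_time_def
proof (rule reaches_Seq)
  show "reaches (put ''K'' (N 1)) s 3 (\<lambda>s. loaded s \<and> s ''K'' 0 = 1)"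
    using assms by (intro reaches_put) (simp add: loaded_def)
next
  fix s1 assume "loaded s1 \<and> s1 ''K'' 0 = 1"
  then have s1: "loaded s1" "s1 ''K'' 0 = 1" by auto
  show "reaches (Seq (for_triangles init_body) (Seq (for_triangles assign_body)
      (Seq (put ''act'' (N 1)) (Seq (While (Less (N 0) (scalar ''act'')) balance_round)
      (for_triangles output_body))))) s1
      ((n * (max_time init_body + 12) + 9) + ((n * (max_time assign_body + 12) + 9) +
        (3 + (main_time + (n * (max_time output_body + 12) + 9)))))
      (\<lambda>s'. \<exists>a. choice a \<and>
        (\<forall>b. choice b \<longrightarrow> (\<Sum>e\<in>Es. (ld a e)\<^sup>2) \<le> (\<Sum>e\<in>Es. (ld b e)\<^sup>2)) \<and>
        (\<forall>i<n. \<forall>j<3. s' ''x'' (3 * i + j) = of_bool (j = a i)))"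
  proof (rule reaches_Seq[OF reaches_init[OF s1]], elim conjE, rule reaches_Seq[OF reaches_assign],
      assumption, assumption, assumption, rule reaches_Seq)
    fix s2 assume s2: "Inv s2 \<and> (\<forall>e\<in>Es. s2 ''q'' e = 0)"
    show "reaches (put ''act'' (N 1)) s2 3
        (\<lambda>s. Inv s \<and> s ''act'' 0 = 1 \<and> (\<forall>e\<in>Es. s ''q'' e = 0))"
      using s2 by (intro reaches_put) (simp add: Inv_def loaded_def)
  next
    fix s3 assume s3: "Inv s3 \<and> s3 ''act'' 0 = 1 \<and> (\<forall>e\<in>Es. s3 ''q'' e = 0)"
    show "reaches (Seq (While (Less (N 0) (scalar ''act'')) balance_round)
      (for_triangles output_body)) s3 (main_time + (n * (max_time output_body + 12) + 9))
      (\<lambda>s'. \<exists>a. choice a \<and>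
        (\<forall>b. choice b \<longrightarrow> (\<Sum>e\<in>Es. (ld a e)\<^sup>2) \<le> (\<Sum>e\<in>Es. (ld b e)\<^sup>2)) \<and>
        (\<forall>i<n. \<forall>j<3. s' ''x'' (3 * i + j) = of_bool (j = a i)))"
    proof (rule reaches_Seq[OF reaches_main])
      fix s4 assume "Inv s4 \<and> (\<forall>i<n. \<not> over s4 i)"
      then have s4: "loaded s4" "valid (s4 ''a'') (s4 ''q'') (s4 ''w'')" "choice (s4 ''a'')"
        and "\<And>i. i < n \<Longrightarrow>
          s4 ''w'' (chosen (s4 ''a'') i) \<le> s4 ''q'' (chosen (s4 ''a'') i) + K"
        by (auto simp: Inv_def over_def not_less valid_def)
      from valid_imp_optimal[OF s4(2) _ this(4)] s4(3)
      show "reaches (for_triangles output_body) s4 (n * (max_time output_body + 12) + 9)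
        (\<lambda>s'. \<exists>a. choice a \<and>
          (\<forall>b. choice b \<longrightarrow> (\<Sum>e\<in>Es. (ld a e)\<^sup>2) \<le> (\<Sum>e\<in>Es. (ld b e)\<^sup>2)) \<and>
          (\<forall>i<n. \<forall>j<3. s' ''x'' (3 * i + j) = of_bool (j = a i)))"
        by (intro reaches_mono[OF reaches_output[OF s4(1,3)]]) auto
    qed (use s3 in auto)
  qed
qed

end

text \<open>The number of rounds is cubic, as \<open>K\<close> is linear in \<open>n\<close>, and a
  round takes linear time. Unfolding the program texts turns every \<open>max_time\<close> into a
  numeral.\<close>

lemma total_time_bigo: "(\<lambda>n. real (triangle_table.total_time n)) \<in> O(\<lambda>n. real n ^ 4)"
  unfolding triangle_table.total_time_def triangle_table.main_time_def triangle_table.round_time_def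
    triangle_table.K_def init_body_def assign_body_def output_body_def scan_body_def try_option_def
    update_def push_def relabel_def overfull_def
  by simp real_asymp

section \<open>From the table back to the graph\<close>

lemma card_triangle:
  assumes "simple_graph V E" "T \<in> triangles E"
  shows "card T = 3"
proof -
  obtain u v w where T: "T = {{u, v}, {v, w}, {u, w}}" "{u, v} \<in> E" "{v, w} \<in> E" "{u, w} \<in> E"
    using assms(2) by (auto simp: triangles_def)
  then have "card {u, v} = 2" "card {v, w} = 2" "card {u, w} = 2"
    using assms(1) by (auto simp: simple_graph_def)
  then have "u \<noteq> v" "v \<noteq> w" "u \<noteq> w" by auto
  then show ?thesis by (simp add: T(1) doubleton_eq_iff)
qed

locale encoded_graph =
  fixes V :: "'a set" and E es ts s
  assumes graph: "simple_graph V E" and encodes: "encodes E es ts s"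
begin

sublocale triangle_table "length ts" "s ''table''" .

abbreviation edge :: "nat \<Rightarrow> nat \<Rightarrow> 'a set" where
  "edge i j \<equiv> es ! option i j"

lemma option_less: "i < length ts \<Longrightarrow> j < 3 \<Longrightarrow> option i j < length es"
  using encodes by (simp add: encodes_def option_def)

lemma nth_triangle: "i < length ts \<Longrightarrow> ts ! i = edge i ` {..<3}"
  using encodes by (auto simp: encodes_def option_def)

lemma distinct_ts: "distinct ts" and set_ts: "set ts = triangles E"
  using encodes by (simp_all add: encodes_def)

lemma nth_triangle_mem: "i < length ts \<Longrightarrow> ts ! i \<in> triangles E"
  using nth_mem[of i ts] by (simp add: set_ts)

lemma triangles_eq: "triangles E = (!) ts ` {..<length ts}"
  by (auto simp: set_ts[symmetric] in_set_conv_nth)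

lemma inj_nth_triangles: "inj_on ((!) ts) {..<length ts}"
  using distinct_ts by (auto simp: inj_on_def nth_eq_iff_index_eq)

lemma inj_edge: "i < length ts \<Longrightarrow> inj_on (edge i) {..<3}"
  using card_triangle[OF graph nth_triangle_mem, of i] nth_triangle[of i]
  by (intro eq_card_imp_inj_on) auto

text \<open>The dictionary between 0/1 solutions and choice functions: \<open>b i\<close> is the
  table position at which triangle \<open>i\<close> has its 1.\<close>

definition follows :: "('a set set \<Rightarrow> 'a set \<Rightarrow> nat) \<Rightarrow> (nat \<Rightarrow> nat) \<Rightarrow> bool" where
  "follows y b \<longleftrightarrow> choice b \<and> (\<forall>i<length ts. \<forall>j<3. y (ts ! i) (edge i j) = of_bool (j = b i))"

lemma sum_triangle:
  fixes y :: "'a set \<Rightarrow> nat"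
  assumes "i < length ts"
  shows "(\<Sum>e\<in>ts ! i. y e) = y (edge i 0) + y (edge i 1) + y (edge i 2)"
proof -
  have "(\<Sum>e\<in>ts ! i. y e) = (\<Sum>j<3. y (edge i j))"
    using assms by (simp add: nth_triangle sum.reindex[OF inj_edge])
  then show ?thesis by (simp add: numeral_3_eq_3 numeral_2_eq_2)
qed

lemma feasible_iff: "feasible E y \<longleftrightarrow> (\<exists>b. follows y b)"
proof
  assume y: "feasible E y"
  have "\<exists>j<3. \<forall>j'<3. y (ts ! i) (edge i j') = of_bool (j' = j)" if i: "i < length ts" for i
  proof -
    have "y (ts ! i) (edge i 0) + y (ts ! i) (edge i 1) + y (ts ! i) (edge i 2) = 1"
      using y nth_triangle_mem[OF i] sum_triangle[OF i, of "y (ts ! i)"] by (auto simp: feasible_def)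
    then consider "y (ts ! i) (edge i 0) = 1" "y (ts ! i) (edge i 1) = 0" "y (ts ! i) (edge i 2) = 0"
      | "y (ts ! i) (edge i 0) = 0" "y (ts ! i) (edge i 1) = 1" "y (ts ! i) (edge i 2) = 0"
      | "y (ts ! i) (edge i 0) = 0" "y (ts ! i) (edge i 1) = 0" "y (ts ! i) (edge i 2) = 1"
      by linarith
    then show ?thesis
    proof cases
      case 1
      then show ?thesis by (intro exI[of _ 0]) (simp add: all_less_3)
    next
      case 2
      then show ?thesis by (intro exI[of _ 1]) (simp add: all_less_3)
    next
      case 3
      then show ?thesis by (intro exI[of _ 2]) (simp add: all_less_3)
    qed
  qed
  then show "\<exists>b. follows y b"
    unfolding follows_def choice_def by metis
next
  assume "\<exists>b. follows y b"
  then obtain b where b: "follows y b" ..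
  have "(\<Sum>e\<in>T. y T e) = 1 \<and> (\<forall>e\<in>T. y T e \<in> {0, 1})" if T: "T \<in> triangles E" for T
  proof -
    obtain i where i: "i < length ts" "T = ts ! i"
      using T by (auto simp: triangles_eq)
    have "b i < 3" using b i by (simp add: follows_def choice_def)
    then have "b i = 0 \<or> b i = 1 \<or> b i = 2" by auto
    then have "(\<Sum>e\<in>T. y T e) = 1"
      using b i by (auto simp: sum_triangle follows_def)
    moreover have "y T e \<in> {0, 1}" if "e \<in> T" for e
      using that b i by (force simp: nth_triangle follows_def)
    ultimately show ?thesis by blast
  qed
  then show "feasible E y" by (auto simp: feasible_def)
qed

text \<open>The inner sum at an edge counts the triangles charged to it, and edges in no triangle
  contribute 0, so the cost is carried by \<open>Es\<close>.\<close>

lemma cost_eq: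
  assumes "follows y b"
  shows "cost E y = (\<Sum>e\<in>Es. (ld b e)\<^sup>2)"
proof -
  have es: "distinct es" "E = (!) es ` {..<length es}"
    using encodes by (auto simp: encodes_def in_set_conv_nth)
  have b: "choice b" "\<And>i j. i < length ts \<Longrightarrow> j < 3 \<Longrightarrow> y (ts ! i) (edge i j) = of_bool (j = b i)"
    using assms by (auto simp: follows_def)
  have inner: "(\<Sum>T\<in>{T \<in> triangles E. es ! k \<in> T}. y T (es ! k)) = ld b k" if k: "k < length es" for k
  proof -
    have "{T \<in> triangles E. es ! k \<in> T} = (!) ts ` {i \<in> {..<length ts}. es ! k \<in> ts ! i}"
      by (auto simp: triangles_eq)
    then have "(\<Sum>T\<in>{T \<in> triangles E. es ! k \<in> T}. y T (es ! k)) =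
        (\<Sum>i\<in>{i \<in> {..<length ts}. es ! k \<in> ts ! i}. y (ts ! i) (es ! k))"
      by (simp only: sum.reindex[OF inj_on_subset[OF inj_nth_triangles]] Collect_restrict comp_def)
    also have "\<dots> = (\<Sum>i\<in>{i \<in> {..<length ts}. es ! k \<in> ts ! i}. of_bool (chosen b i = k))"
    proof (rule sum.cong)
      fix i assume "i \<in> {i \<in> {..<length ts}. es ! k \<in> ts ! i}"
      then obtain j where j: "i < length ts" "j < 3" "es ! k = edge i j"
        by (auto simp: nth_triangle)
      have bi: "b i < 3" using b(1) j by (simp add: choice_def)
      \<comment> \<open>Distinctness of \<open>es\<close> lets edges be compared by number; the
        three edges of a triangle being distinct then pins down the position.\<close>
      have "chosen b i = k \<longleftrightarrow> edge i (b i) = es ! k"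
        using es(1) k option_less[OF j(1) bi] by (simp add: chosen_def nth_eq_iff_index_eq)
      also have "\<dots> \<longleftrightarrow> j = b i"
        using inj_edge[OF j(1)] bi j by (auto simp: inj_on_def)
      finally show "y (ts ! i) (es ! k) = of_bool (chosen b i = k)"
        using b(2)[OF j(1,2)] j(3) by simp
    qed simp
    also have "\<dots> = (\<Sum>i<length ts. of_bool (chosen b i = k))"
    \<comment> \<open>A triangle that does not contain the edge cannot be charged to it.\<close>
    proof (rule sum.mono_neutral_left)
      show "\<forall>i\<in>{..<length ts} - {i \<in> {..<length ts}. es ! k \<in> ts ! i}. of_bool (chosen b i = k) = (0::nat)"
        using b(1) by (auto simp: nth_triangle chosen_def choice_def)
    qed auto
    finally show ?thesis by (simp only: load_eq_sum finite_lessThan)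
  qed
  have "cost E y = (\<Sum>k<length es. (\<Sum>T\<in>{T \<in> triangles E. es ! k \<in> T}. y T (es ! k))\<^sup>2)"
    unfolding cost_def using es by (simp add: sum.reindex inj_on_nth)
  also have "\<dots> = (\<Sum>k<length es. (ld b k)\<^sup>2)"
    by (simp add: inner)
  also have "\<dots> = (\<Sum>k\<in>Es. (ld b k)\<^sup>2)"
  proof (rule sum.mono_neutral_right)
    show "Es \<subseteq> {..<length es}" using option_less by (auto simp: Es_def)
    show "\<forall>k\<in>{..<length es} - Es. (ld b k)\<^sup>2 = 0"
      using chosen_in_Es[OF b(1)] by (auto intro!: load_eq_0)
  qed simp
  finally show ?thesis .
qed

lemma balance_optimal:
  "\<exists>t s' x. runs balance s t s' \<and> t \<le> total_time \<and> outputs es ts s s' x \<and> optimal E x"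
proof -
  have "loaded s" using encodes by (simp add: loaded_def encodes_def)
  from reaches_balance[OF this] obtain t s' a where run: "runs balance s t s'" "t \<le> total_time"
    and a: "choice a" "\<And>b. choice b \<Longrightarrow> (\<Sum>e\<in>Es. (ld a e)\<^sup>2) \<le> (\<Sum>e\<in>Es. (ld b e)\<^sup>2)"
    and out: "\<And>i j. i < length ts \<Longrightarrow> j < 3 \<Longrightarrow> s' ''x'' (3 * i + j) = of_bool (j = a i)"
    unfolding reaches_def by blast
  \<comment> \<open>A solution takes triangles, not their numbers, as arguments; since
    \<open>ts\<close> is distinct, at most one \<open>i\<close> can serve as witness.\<close>
  define x :: "'a set set \<Rightarrow> 'a set \<Rightarrow> nat" where
    "x T e = of_bool (\<exists>i<length ts. T = ts ! i \<and> e = edge i (a i))" for T e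
  have "x (ts ! i) (edge i j) = of_bool (j = a i)" if "i < length ts" "j < 3" for i j
  proof -
    have "x (ts ! i) (edge i j) = of_bool (edge i j = edge i (a i))"
      using inj_nth_triangles that by (auto simp: x_def inj_on_def)
    also have "edge i j = edge i (a i) \<longleftrightarrow> j = a i"
      using inj_edge[OF that(1)] that a(1) by (auto simp: inj_on_def choice_def)
    finally show ?thesis .
  qed
  then have x: "follows x a" using a(1) by (simp add: follows_def)
  have "outputs es ts s s' x"
    using x out by (simp add: outputs_def follows_def option_def)
  moreover have "optimal E x"
    unfolding optimal_def
  proof (intro conjI allI impI)
    show "feasible E x" using x feasible_iff by blast
    fix y assume "feasible E y"
    then obtain b where b: "follows y b" using feasible_iff by blast
    then have "choice b" by (simp add: follows_def)
    with a(2) show "cost E x \<le> cost E y" by (simp only: cost_eq[OF x] cost_eq[OF b])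
  qed
  ultimately show ?thesis using run by blast
qed

end

theorem mainTheorem3:
  "\<exists>c T. solves_in_time TYPE('a) c T \<and> (\<lambda>n. real (T n)) \<in> O(\<lambda>n. real n ^ 4)"
proof (intro exI conjI)
  show "solves_in_time TYPE('a) balance triangle_table.total_time"
    unfolding solves_in_time_def
  proof (intro allI impI)
    fix V :: "'a set" and E es ts s
    assume "simple_graph V E" "encodes E es ts s"
    then interpret encoded_graph V E es ts s by unfold_locales
    have "card (triangles E) = length ts"
      using encodes by (metis encodes_def distinct_card)
    with balance_optimal show "\<exists>t s' x. runs balance s t s' \<and>
        t \<le> triangle_table.total_time (card (triangles E)) \<and> outputs es ts s s' x \<and> optimal E x"
      by simp
  qed
qed (rule total_time_bigo)

end
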